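(* For all integers $n\ge 0$ and $\alpha\ge 1$, every prime $p\ge 3$, and every $j\in\{1,2,\ldots,p-1\}$, $$d\left(2p^{2\alpha}n+\frac{(8j+p)p^{2\alpha-1}-1}{4}\right)\equiv 0\pmod 2.$$
   Context: For a positive integer $k$, $(q^k;q^k)_\infty:=\prod_{m\ge 1}(1-q^{km})$, viewed as a formal power series in $q$ with integer coefficients. The integers $d(n)$ ($n\ge 0$) are defined by the generating function $$\sum_{n=0}^\infty d(n)q^n=\frac{(q^3;q^3)_\infty^3}{(q;q)_\infty(q^2;q^2)_\infty}.$$ *)

theory Defs
  imports
    "HOL-Analysis.Infinite_Products"
    "HOL-Computational_Algebra.Formal_Power_Series"
    "HOL-Number_Theory.Cong"
begin

text \<open>\<open>qprod k\<close> is $(q^k;q^k)_\infty$. The infinite product is the library's, taken in the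
  metric topology of formal power series. The index \<open>m\<close> starts at 0, hence the
  \<open>Suc m\<close>.\<close>

definition qprod :: "nat \<Rightarrow> int fps" where
  "qprod k = (\<Prod>m. 1 - fps_X ^ (k * Suc m))"

text \<open>There is no division on \<open>int fps\<close>, so the quotient is formed with
  \<open>fps_right_inverse f 1\<close>, the inverse of a power series \<open>f\<close> with constant coefficient 1;
  see \<open>d_generating_function\<close>.\<close>

definition d :: "nat \<Rightarrow> int" where
  "d n = fps_nth (qprod 3 ^ 3 * fps_right_inverse (qprod 1 * qprod 2) 1) n"

lemma qprod_aux:
  assumes "k > 0"
  shows "\<exists>P :: int fps. (\<lambda>m. 1 - fps_X ^ (k * Suc m)) has_prod P \<and> fps_nth P 0 = 1"
proof -
  define F :: "nat \<Rightarrow> int fps" where "F = (\<lambda>n. \<Prod>m\<le>n. 1 - fps_X ^ (k * Suc m))"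
  define P where "P = Abs_fps (\<lambda>n. fps_nth (F n) n)"
  have step: "fps_nth (F (Suc n)) i = fps_nth (F n) i" if "i \<le> n" for i n
  proof -
    have "F (Suc n) = F n - F n * fps_X ^ (k * Suc (Suc n))"
      by (simp add: F_def algebra_simps)
    moreover have "i < k * Suc (Suc n)"
      using that assms by (cases k) auto
    ultimately show ?thesis
      by (simp add: fps_X_power_mult_right_nth)
  qed
  have stable: "fps_nth (F n) i = fps_nth P i" if "i \<le> n" for i n
    using that by (induction n rule: dec_induct) (simp_all add: step P_def)
  have "F \<longlonglongrightarrow> P"
    by (rule tendsto_fpsI) (rule eventually_mono[OF eventually_ge_at_top stable])
  moreover have P0: "fps_nth P 0 = 1"
    using assms by (simp add: P_def F_def)
  moreover from P0 have "P \<noteq> 0"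
    by auto
  ultimately show ?thesis
    by (auto simp: has_prod_def raw_has_prod_def F_def)
qed

lemma qprod_has_prod:
  assumes "k > 0"
  shows "(\<lambda>m. 1 - fps_X ^ (k * Suc m)) has_prod qprod k"
  using qprod_aux[OF assms] has_prod_unique unfolding qprod_def by metis

lemma qprod_nth_0:
  assumes "k > 0"
  shows "fps_nth (qprod k) 0 = 1"
  using qprod_aux[OF assms] has_prod_unique unfolding qprod_def by metis

lemma d_generating_function: "Abs_fps d * (qprod 1 * qprod 2) = qprod 3 ^ 3"
proof -
  have "qprod 1 * qprod 2 * fps_right_inverse (qprod 1 * qprod 2) 1 = 1"
    by (rule fps_right_inverse) (simp add: qprod_nth_0)
  moreover have "Abs_fps d = qprod 3 ^ 3 * fps_right_inverse (qprod 1 * qprod 2) 1"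
    by (simp add: fps_eq_iff d_def)
  ultimately show ?thesis
    by (simp add: mult_ac)
qed

text \<open>The natural-number division in the argument of \<open>d\<close> in the theorem is exact.\<close>

lemma index_division_exact:
  fixes p j \<alpha> :: nat
  assumes "odd p" "\<alpha> \<ge> 1"
  shows "4 dvd (8 * j + p) * p ^ (2 * \<alpha> - 1) - 1"
proof -
  obtain c where c: "p ^ \<alpha> = 2 * c + 1"
    using assms by (metis even_power oddE)
  have "p * p ^ (2 * \<alpha> - 1) = (p ^ \<alpha>)\<^sup>2"
    using assms by (cases \<alpha>) (simp_all add: power2_eq_square power_add[symmetric] mult_2)
  also have "\<dots> = 4 * (c * c + c) + 1"
    by (simp add: c power2_eq_square algebra_simps)
  finally have "(8 * j + p) * p ^ (2 * \<alpha> - 1) - 1 = 4 * (2 * j * p ^ (2 * \<alpha> - 1) + c * c + c)"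
    by (simp add: algebra_simps)
  then show ?thesis
    by simp
qed

end

theory Submission
  imports Defs
begin

text \<open>
  Write \<open>f k\<close> for \<open>qprod k\<close> and \<open>D\<close> for the generating function of \<open>d\<close>, so that
  \<open>D * f 1 * f 2 = f 3 ^ 3\<close>. The idea is that the even-indexed coefficients of \<open>D\<close>, read modulo 2,
  form a theta series: \<open>d (2 * m)\<close> can be odd only if \<open>m\<close> is a triangular number, that is, only if
  \<open>8 * m + 1\<close> is a square.

  Three specializations of the Jacobi triple product give exact identities. With
  \<open>theta a b\<close> the sum of $(-1)^l q^{(a+b)l(l-1)/2+al}$ over all integers \<open>l\<close>, they are
  \<open>f 1 * f 6 * f 6 = f 2 * f 3 * theta 1 5\<close>, \<open>f k = theta k (2 * k)\<close> (Euler's pentagonal number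
  theorem) and \<open>f 1 * f 4 = f 2 * theta 1 3\<close>. The finite form of the triple product is proved with
  Gaussian binomial coefficients; the limit is taken coefficient by coefficient.

  Modulo 2 one has \<open>f (2 * k) = f k ^ 2\<close>. The first identity then becomes
  \<open>f 3 ^ 3 = f 1 * theta 1 5\<close>, whence \<open>D * f 2 = theta 1 5\<close>. As \<open>f 2\<close> is a series in $q^2$, taking the
  even-indexed coefficients of both sides gives \<open>E * f 1\<close> on the left, where \<open>E\<close> is the series of
  the \<open>d (2 * m)\<close>. On the right, the exponent $3l^2-2l$ is even exactly for \<open>l = 2 * k\<close>, and half of
  it is then $6k^2-2k$, so that the right-hand side becomes \<open>theta 4 8 = f 4\<close>. Finally
  \<open>f 1 ^ 3 * E = f 1 ^ 2 * f 4 = f 1 * f 2 * theta 1 3 = f 1 ^ 3 * theta 1 3\<close> modulo 2, so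
  \<open>E = theta 1 3\<close>, and the exponents $2l^2-l$ of \<open>theta 1 3\<close> are the triangular numbers.

  The index in the theorem is \<open>2 * m\<close> with $8m+1=p^{2\alpha-1}(8pn+8j+p)$. The second factor is prime
  to \<open>p\<close>, so \<open>p\<close> divides \<open>8 * m + 1\<close> to an odd power and \<open>8 * m + 1\<close> is not a square.
\<close>

section \<open>Gaussian binomial coefficients\<close>

fun gauss_binomial :: "'a::comm_ring_1 \<Rightarrow> nat \<Rightarrow> nat \<Rightarrow> 'a" where
  "gauss_binomial Q n 0 = 1"
| "gauss_binomial Q 0 (Suc k) = 0"
| "gauss_binomial Q (Suc n) (Suc k) =
     gauss_binomial Q n k + Q ^ Suc k * gauss_binomial Q n (Suc k)"

lemma gauss_binomial_eq_0: "n < k \<Longrightarrow> gauss_binomial Q n k = 0"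
  by (induction Q n k rule: gauss_binomial.induct) auto

text \<open>The defining recursion is one of the two \<open>Q\<close>-analogues of Pascal's rule; this is the other one.
  Both are needed for the finite triple product, because its two families of factors extend the
  range of summation at opposite ends.\<close>

lemma gauss_binomial_pascal:
  "k \<le> n \<Longrightarrow> gauss_binomial Q (Suc n) (Suc k) =
     Q ^ (n - k) * gauss_binomial Q n k + gauss_binomial Q n (Suc k)"
proof (induction n arbitrary: k)
  case (Suc n)
  show ?case
  proof (cases k)
    case 0
    with Suc.IH[of 0] show ?thesis by (simp add: algebra_simps)
  next
    case (Suc i)
    note k = this
    show ?thesis
    proof (cases "k \<le> n")
      case True
      let ?G = "gauss_binomial Q"
      have "Suc k + (n - k) = (n - i) + k" using True k by simp
      then have exps: "Q ^ Suc k * Q ^ (n - k) = Q ^ (n - i) * Q ^ k"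
        by (metis power_add)
      have "?G (Suc (Suc n)) (Suc k) = ?G (Suc n) k + Q ^ Suc k * ?G (Suc n) (Suc k)"
        by (rule gauss_binomial.simps(3))
      also have "?G (Suc n) k = Q ^ (n - i) * ?G n i + ?G n k"
        using Suc.IH[of i] True k by simp
      also have "?G (Suc n) (Suc k) = Q ^ (n - k) * ?G n k + ?G n (Suc k)"
        using Suc.IH[of k] True by simp
      also have "Q ^ (n - i) * ?G n i + ?G n k + Q ^ Suc k * (\<dots>) =
          Q ^ (n - i) * ?G n i + ?G n k + (Q ^ Suc k * Q ^ (n - k)) * ?G n k + Q ^ Suc k * ?G n (Suc k)"
        by (simp only: distrib_left mult.assoc add.assoc)
      also have "\<dots> = Q ^ (n - i) * (?G n i + Q ^ k * ?G n k) + (?G n k + Q ^ Suc k * ?G n (Suc k))"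
        unfolding exps by (simp only: distrib_left mult.assoc add.assoc add.commute add.left_commute)
      also have "?G n i + Q ^ k * ?G n k = ?G (Suc n) k"
        using k by simp
      also have "?G n k + Q ^ Suc k * ?G n (Suc k) = ?G (Suc n) (Suc k)"
        by simp
      finally show ?thesis using k by simp
    next
      case False
      with k Suc.prems have "i = n" by simp
      with k Suc.IH[of i] show ?thesis by (simp add: gauss_binomial_eq_0)
    qed
  qed
qed simp

text \<open>The usual quotient formula, with the denominators multiplied out so that it holds in every
  commutative ring.\<close>

lemma gauss_binomial_prod:
  "k \<le> n \<Longrightarrow> gauss_binomial Q n k * (\<Prod>i<k. 1 - Q ^ Suc i) * (\<Prod>i<n - k. 1 - Q ^ Suc i) =
     (\<Prod>i<n. 1 - Q ^ Suc i)"
proof (induction n arbitrary: k)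
  case (Suc n)
  define P where "P j = (\<Prod>i<j. 1 - Q ^ Suc i)" for j
  have P_Suc: "P (Suc j) = P j * (1 - Q ^ Suc j)" for j
    by (simp add: P_def)
  have P0: "P 0 = 1" by (simp add: P_def)
  have IH: "gauss_binomial Q n k * P k * P (n - k) = P n" if "k \<le> n" for k
    using Suc.IH that by (simp add: P_def)
  have "gauss_binomial Q (Suc n) k * P k * P (Suc n - k) = P (Suc n)"
  proof (cases k)
    case (Suc i)
    note k = this
    have "gauss_binomial Q (Suc n) k * P k * P (Suc n - k) =
        gauss_binomial Q n i * P i * P (n - i) * (1 - Q ^ Suc i)
        + Q ^ Suc i * (gauss_binomial Q n (Suc i) * P (Suc i) * P (n - i))"
      using k by (simp add: P_Suc algebra_simps)
    also have "gauss_binomial Q n (Suc i) * P (Suc i) * P (n - i) = P n * (1 - Q ^ (n - i))"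
    proof (cases "i = n")
      case False
      with k Suc.prems have "Suc i \<le> n" "n - i = Suc (n - Suc i)" by auto
      then show ?thesis
        using IH[of "Suc i"] P_Suc[of "n - Suc i"] by (metis mult.assoc)
    qed (simp add: gauss_binomial_eq_0)
    also have "gauss_binomial Q n i * P i * P (n - i) = P n"
      using k Suc.prems by (intro IH) simp
    also have "P n * (1 - Q ^ Suc i) + Q ^ Suc i * (P n * (1 - Q ^ (n - i))) =
        P n * (1 - Q ^ Suc i * Q ^ (n - i))"
      by (simp add: algebra_simps)
    also have "Q ^ Suc i * Q ^ (n - i) = Q ^ Suc n"
      unfolding power_add[symmetric] using k Suc.prems by simp
    finally show ?thesis by (simp only: P_Suc)
  qed (simp add: P0)
  then show ?case by (simp add: P_def)
qed simp

section \<open>Theta series and the finite Jacobi triple product\<close>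

definition theta_exp :: "nat \<Rightarrow> nat \<Rightarrow> int \<Rightarrow> int" where
  "theta_exp a b l = int (a + b) * (l * (l - 1) div 2) + int a * l"

definition theta_term :: "nat \<Rightarrow> nat \<Rightarrow> int \<Rightarrow> int fps" where
  "theta_term a b l = (if even l then 1 else - 1) * fps_X ^ nat (theta_exp a b l)"

text \<open>If \<open>a\<close> and \<open>b\<close> are positive, only finitely many \<open>l\<close> have a given exponent (see
  \<open>abs_le_theta_exp\<close>), so that every coefficient is a finite sum. It is a sum over all solutions
  \<open>l\<close> because different \<open>l\<close> may share an exponent.\<close>

definition theta :: "nat \<Rightarrow> nat \<Rightarrow> int fps" where
  "theta a b = Abs_fps (\<lambda>t. \<Sum>l | theta_exp a b l = int t. if even l then 1 else - 1)"

text \<open>Doubling the exponent removes the division, which leaves a polynomial identity.\<close>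

lemma two_theta_exp: "2 * theta_exp a b l = int (a + b) * (l * (l - 1)) + 2 * int a * l"
proof -
  define h where "h = l * (l - 1) div 2"
  have "l * (l - 1) = 2 * h" by (simp add: h_def)
  then show ?thesis unfolding theta_exp_def h_def[symmetric] by simp
qed

lemma theta_exp_step: "theta_exp a b (l + 1) = theta_exp a b l + int (a + b) * l + int a"
proof -
  have "2 * theta_exp a b (l + 1) = 2 * (theta_exp a b l + int (a + b) * l + int a)"
    by (simp only: two_theta_exp distrib_left) (simp add: algebra_simps)
  then show ?thesis by simp
qed

text \<open>For negative \<open>l = - r\<close> the exponent equals \<open>(a + b) * (r * (r - 1) div 2) + b * r\<close>: the
  substitution \<open>l \<mapsto> - l\<close> exchanges \<open>a\<close> and \<open>b\<close>, so both signs of \<open>l\<close> obey the same bound.\<close>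

lemma abs_le_theta_exp:
  assumes "a > 0" "b > 0"
  shows "\<bar>l\<bar> \<le> theta_exp a b l"
proof (cases "l \<ge> 0")
  case True
  have "1 * l \<le> int a * l" using True assms by (intro mult_right_mono) auto
  moreover have "0 \<le> l * (l - 1) div 2" using True by (cases "l = 0") auto
  ultimately show ?thesis using True by (simp add: theta_exp_def add_increasing)
next
  case False
  define r where "r = - l"
  have r: "r \<ge> 1" "l = - r" using False by (auto simp: r_def)
  have "2 * theta_exp a b l = int (a + b) * (r * (r - 1)) + 2 * (int b * r)"
    by (simp add: two_theta_exp r algebra_simps)
  moreover have "1 * r \<le> int b * r" using r assms by (intro mult_right_mono) auto
  moreover have "0 \<le> int (a + b) * (r * (r - 1))" using r by simp
  ultimately show ?thesis using r by linarith
qed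

lemma theta_exp_nonneg: "a > 0 \<Longrightarrow> b > 0 \<Longrightarrow> 0 \<le> theta_exp a b l"
  using abs_le_theta_exp[of a b l] by linarith

text \<open>The next two lemmas express the recursion of the exponents in the form in which
  multiplication by a further factor of the product uses it: a factor \<open>1 - fps_X ^ ((a + b) * i + a)\<close>
  moves terms up by one place, a factor \<open>1 - fps_X ^ ((a + b) * i + b)\<close> moves them down.\<close>

lemma theta_term_step_up:
  assumes "a > 0" "b > 0"
  shows "theta_term a b (int k + 1) = - (fps_X ^ ((a + b) * k + a) * theta_term a b (int k))"
proof -
  have "nat (theta_exp a b (int k + 1)) = (a + b) * k + a + nat (theta_exp a b (int k))"
    using abs_le_theta_exp[OF assms, of "int k"] abs_le_theta_exp[OF assms, of "int k + 1"]
    by (subst int_int_eq[symmetric]) (simp add: theta_exp_step)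
  then show ?thesis by (simp add: theta_term_def power_add)
qed

lemma theta_term_step_down:
  assumes "a > 0" "b > 0"
  shows "fps_X ^ ((a + b) * k) * theta_term a b (int k - int (Suc s)) =
    - (fps_X ^ ((a + b) * s + b) * theta_term a b (int k - int s))"
proof -
  define l where "l = int k - int (Suc s)"
  have l: "int k - int s = l + 1" "int k = l + int s + 1" by (auto simp: l_def)
  have "(a + b) * k + nat (theta_exp a b l) = (a + b) * s + b + nat (theta_exp a b (l + 1))"
    using theta_exp_nonneg[OF assms, of l] theta_exp_nonneg[OF assms, of "l + 1"]
      theta_exp_step[of a b l]
    by (subst int_int_eq[symmetric]) (simp add: l(2) distrib_left distrib_right mult.commute)
  then have "fps_X ^ ((a + b) * k) * fps_X ^ nat (theta_exp a b l) =
      (fps_X ^ ((a + b) * s + b) * fps_X ^ nat (theta_exp a b (l + 1)) :: int fps)"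
    by (simp only: power_add[symmetric])
  then show ?thesis unfolding l(1) l_def[symmetric] by (simp add: theta_term_def)
qed

lemma mult_interchange:
  fixes x y g w w' :: "'a::comm_ring_1"
  assumes "x * w = - (y * w')"
  shows "x * g * w = - (y * (g * w'))"
proof -
  have "x * g * w = g * (x * w)" by (simp add: mult_ac)
  also have "\<dots> = - (y * (g * w'))" unfolding assms by (simp add: mult_ac)
  finally show ?thesis .
qed

text \<open>The numbers of factors of the two kinds are independent of each other, so the identity can be
  proved by adding one factor at a time: first those of the kind \<open>a\<close> with \<open>gauss_binomial_pascal\<close>, then
  those of the kind \<open>b\<close> with the defining recursion. The offset \<open>s\<close> in the summation keeps the index of
  the Gaussian binomial coefficient a natural number.\<close>

lemma finite_jacobi_triple_product:
  fixes a b r s :: nat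
  assumes "a > 0" "b > 0"
  defines "m \<equiv> a + b"
  shows "(\<Prod>i<r. 1 - fps_X ^ (m * i + a)) * (\<Prod>i<s. 1 - fps_X ^ (m * i + b)) =
    (\<Sum>k\<le>r + s. gauss_binomial (fps_X ^ m) (r + s) k * theta_term a b (int k - int s))"
proof (induction s)
  case 0
  show ?case
  proof (induction r)
    case 0
    show ?case by (simp add: theta_term_def theta_exp_def)
  next
    case (Suc r)
    let ?G = "gauss_binomial (fps_X ^ m :: int fps)" and ?W = "\<lambda>k. theta_term a b (int k)"
    have "(\<Sum>k\<le>Suc r. ?G (Suc r) k * ?W k) =
        ?W 0 + (\<Sum>k\<le>r. ?G (Suc r) (Suc k) * ?W (Suc k))"
      by (subst sum.atMost_Suc_shift) simp
    also have "(\<Sum>k\<le>r. ?G (Suc r) (Suc k) * ?W (Suc k)) =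
        (\<Sum>k\<le>r. ?G r (Suc k) * ?W (Suc k) - fps_X ^ (m * r + a) * (?G r k * ?W k))"
    proof (rule sum.cong[OF refl])
      fix k assume "k \<in> {..r}"
      then have k: "k \<le> r" by simp
      have "m * (r - k) + (m * k + a) = m * r + a"
        using k by (simp add: add_mult_distrib2[symmetric])
      then have "(fps_X ^ m) ^ (r - k) * fps_X ^ (m * k + a) = (fps_X ^ (m * r + a) :: int fps)"
        by (simp only: power_mult[symmetric] power_add[symmetric])
      moreover have "?W (Suc k) = - (fps_X ^ (m * k + a) * ?W k)"
        using theta_term_step_up[OF assms(1,2), of k] by (simp add: m_def add.commute)
      ultimately have "(fps_X ^ m) ^ (r - k) * ?W (Suc k) = - (fps_X ^ (m * r + a) * ?W k)"
        by (metis mult.assoc mult_minus_right)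
      from mult_interchange[OF this]
      have "(fps_X ^ m) ^ (r - k) * ?G r k * ?W (Suc k) =
          - (fps_X ^ (m * r + a) * (?G r k * ?W k))" .
      then show "?G (Suc r) (Suc k) * ?W (Suc k) =
          ?G r (Suc k) * ?W (Suc k) - fps_X ^ (m * r + a) * (?G r k * ?W k)"
        by (simp add: gauss_binomial_pascal[OF k] distrib_right del: gauss_binomial.simps)
    qed
    also have "\<dots> = (\<Sum>k\<le>r. ?G r (Suc k) * ?W (Suc k))
        - fps_X ^ (m * r + a) * (\<Sum>k\<le>r. ?G r k * ?W k)"
      by (simp only: sum_subtractf sum_distrib_left)
    also have "?W 0 + (\<dots>) = (\<Sum>k\<le>Suc r. ?G r k * ?W k)
        - fps_X ^ (m * r + a) * (\<Sum>k\<le>r. ?G r k * ?W k)"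
      by (subst sum.atMost_Suc_shift) simp
    also have "\<dots> = (\<Sum>k\<le>r. ?G r k * ?W k) * (1 - fps_X ^ (m * r + a))"
      by (simp add: gauss_binomial_eq_0 algebra_simps)
    finally show ?case using Suc.IH by (simp del: gauss_binomial.simps)
  qed
next
  case (Suc s)
  define n where "n = r + s"
  let ?G = "gauss_binomial (fps_X ^ m :: int fps)" and ?W = "\<lambda>s k. theta_term a b (int k - int s)"
  have "(\<Sum>k\<le>Suc n. ?G (Suc n) k * ?W (Suc s) k) =
      ?W (Suc s) 0 + (\<Sum>k\<le>n. ?G (Suc n) (Suc k) * ?W s k)"
    by (subst sum.atMost_Suc_shift) simp
  also have "(\<Sum>k\<le>n. ?G (Suc n) (Suc k) * ?W s k) = (\<Sum>k\<le>n. ?G n k * ?W s k)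
      + (\<Sum>k\<le>n. (fps_X ^ m) ^ Suc k * ?G n (Suc k) * ?W (Suc s) (Suc k))"
    by (simp add: distrib_right sum.distrib)
  also have "?W (Suc s) 0 + (\<dots>) = (\<Sum>k\<le>n. ?G n k * ?W s k)
      + (\<Sum>k\<le>Suc n. (fps_X ^ m) ^ k * ?G n k * ?W (Suc s) k)"
    by (subst sum.atMost_Suc_shift) simp
  also have "(\<Sum>k\<le>Suc n. (fps_X ^ m) ^ k * ?G n k * ?W (Suc s) k) =
      (\<Sum>k\<le>n. (fps_X ^ m) ^ k * ?G n k * ?W (Suc s) k)"
    by (simp add: gauss_binomial_eq_0)
  also have "\<dots> = (\<Sum>k\<le>n. - (fps_X ^ (m * s + b) * (?G n k * ?W s k)))"
  proof (rule sum.cong[OF refl])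
    fix k
    have "(fps_X ^ m) ^ k * ?W (Suc s) k = - (fps_X ^ (m * s + b) * ?W s k)"
      unfolding m_def power_mult[symmetric] by (rule theta_term_step_down[OF assms(1,2)])
    from mult_interchange[OF this]
    show "(fps_X ^ m) ^ k * ?G n k * ?W (Suc s) k = - (fps_X ^ (m * s + b) * (?G n k * ?W s k))" .
  qed
  also have "(\<Sum>k\<le>n. ?G n k * ?W s k) + (\<dots>) =
      (\<Sum>k\<le>n. ?G n k * ?W s k) * (1 - fps_X ^ (m * s + b))"
    unfolding sum_negf sum_distrib_left[symmetric] by (simp add: left_diff_distrib mult.commute)
  finally show ?case using Suc.IH by (simp add: n_def mult.assoc[symmetric] del: gauss_binomial.simps)
qed

section \<open>Congruences and limits of formal power series\<close>

lemma fps_X_power_dvd_iff: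
  fixes f :: "'a::comm_ring_1 fps"
  shows "fps_X ^ n dvd f \<longleftrightarrow> (\<forall>i<n. fps_nth f i = 0)"
proof
  assume "\<forall>i<n. fps_nth f i = 0"
  then have "f = fps_X ^ n * fps_shift n f"
    by (auto simp: fps_eq_iff fps_X_power_mult_nth)
  then show "fps_X ^ n dvd f" by (metis dvd_triv_left)
qed (auto simp: fps_X_power_mult_nth)

lemma two_dvd_fps_iff: "2 dvd f \<longleftrightarrow> (\<forall>n. even (fps_nth f n))" for f :: "int fps"
proof
  assume "\<forall>n. even (fps_nth f n)"
  then have "f = 2 * Abs_fps (\<lambda>n. fps_nth f n div 2)"
    by (simp add: fps_eq_iff numeral_fps_const)
  then show "2 dvd f" by (metis dvd_triv_left)
qed (auto simp: numeral_fps_const)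

text \<open>Congruence in an arbitrary commutative ring. In rings of power series it serves for two moduli:
  \<open>fps_X ^ Suc t\<close>, for truncation after the coefficient \<open>t\<close>, and 2, for parity.\<close>

definition rcong :: "'a::comm_ring_1 \<Rightarrow> 'a \<Rightarrow> 'a \<Rightarrow> bool" where
  "rcong c x y \<longleftrightarrow> c dvd x - y"

lemma rcong_refl: "rcong c x x"
  by (simp add: rcong_def)

lemma rcong_sym: "rcong c x y \<Longrightarrow> rcong c y x"
  unfolding rcong_def by (metis dvd_minus_iff minus_diff_eq)

lemma rcong_trans [trans]: "rcong c x y \<Longrightarrow> rcong c y z \<Longrightarrow> rcong c x z"
  unfolding rcong_def by (metis dvd_add diff_add_cancel add_diff_eq)

lemma rcong_mult: "rcong c x y \<Longrightarrow> rcong c z w \<Longrightarrow> rcong c (x * z) (y * w)"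
proof -
  assume "rcong c x y" "rcong c z w"
  moreover have "x * z - y * w = (x - y) * z + y * (z - w)" by (simp add: algebra_simps)
  ultimately show ?thesis by (simp add: rcong_def)
qed

lemma rcong_sum: "(\<And>i. i \<in> A \<Longrightarrow> rcong c (f i) (g i)) \<Longrightarrow> rcong c (sum f A) (sum g A)"
  unfolding rcong_def sum_subtractf[symmetric] by (rule dvd_sum)

lemma rcong_prod: "(\<And>i. i \<in> A \<Longrightarrow> rcong c (f i) (g i)) \<Longrightarrow> rcong c (prod f A) (prod g A)"
  by (induction A rule: infinite_finite_induct) (simp_all add: rcong_refl rcong_mult)

text \<open>A series with constant coefficient 1 is a unit, so it cancels modulo anything.\<close>

lemma rcong_fps_cancel:
  fixes u :: "'a::comm_ring_1 fps"
  assumes "rcong c (u * f) (u * g)" "fps_nth u 0 = 1"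
  shows "rcong c f g"
proof -
  define v where "v = fps_right_inverse u 1"
  have "u * v = 1" unfolding v_def using assms(2) by (intro fps_right_inverse) simp
  then have "f = v * (u * f)" "g = v * (u * g)"
    by (metis mult.assoc mult.commute mult_1)+
  then show ?thesis using rcong_mult[OF rcong_refl[of c v] assms(1)] by simp
qed

lemma rcong_fps_X_power: "rcong (fps_X ^ Suc t) f g \<Longrightarrow> fps_nth f t = fps_nth g t"
  by (simp add: rcong_def fps_X_power_dvd_iff del: power_Suc)

lemma tendsto_mult_fps:
  fixes f g :: "nat \<Rightarrow> 'a::comm_ring_1 fps"
  assumes "f \<longlonglongrightarrow> F" "g \<longlonglongrightarrow> G"
  shows "(\<lambda>N. f N * g N) \<longlonglongrightarrow> F * G"
proof (rule tendsto_fpsI)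
  fix n
  have "\<forall>\<^sub>F N in sequentially. \<forall>i\<in>{..n}. fps_nth (f N) i = fps_nth F i \<and> fps_nth (g N) i = fps_nth G i"
    using assms by (intro eventually_ball_finite) (auto simp: tendsto_fps_iff eventually_conj_iff)
  then show "\<forall>\<^sub>F N in sequentially. fps_nth (f N * g N) n = fps_nth (F * G) n"
    by eventually_elim (auto simp: fps_mult_nth intro!: sum.cong)
qed

text \<open>Each coefficient of a convergent sequence is eventually constant, so parity passes to the
  limit.\<close>

lemma rcong_2_tendsto:
  fixes f g :: "nat \<Rightarrow> int fps"
  assumes "f \<longlonglongrightarrow> F" "g \<longlonglongrightarrow> G" "\<And>N. rcong 2 (f N) (g N)"
  shows "rcong 2 F G"
  unfolding rcong_def two_dvd_fps_iff
proof
  fix n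
  have "\<forall>\<^sub>F N in sequentially. fps_nth (f N) n = fps_nth F n \<and> fps_nth (g N) n = fps_nth G n"
    using assms(1,2) by (auto simp: tendsto_fps_iff eventually_conj_iff)
  then obtain N where "fps_nth (f N) n = fps_nth F n" "fps_nth (g N) n = fps_nth G n"
    by (auto simp: eventually_sequentially)
  with assms(3)[of N] show "even (fps_nth (F - G) n)"
    unfolding rcong_def two_dvd_fps_iff by (metis fps_sub_nth)
qed

section \<open>The Jacobi triple product\<close>

definition euler_prod :: "nat \<Rightarrow> nat \<Rightarrow> int fps" where
  "euler_prod k N = (\<Prod>i<N. 1 - fps_X ^ (k * Suc i))"

lemma euler_prod_0 [simp]: "euler_prod k 0 = 1"
  by (simp add: euler_prod_def)

lemma euler_prod_Suc [simp]: "euler_prod k (Suc N) = euler_prod k N * (1 - fps_X ^ (k * Suc N))"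
  by (simp add: euler_prod_def)

text \<open>As a rewrite rule with a numeral for \<open>c\<close>, this unrolls the last \<open>c\<close> factors.\<close>

lemma euler_prod_plus:
  "c > 0 \<Longrightarrow> euler_prod k (M + c) = euler_prod k (M + (c - 1)) * (1 - fps_X ^ (k * (M + c)))"
  by (cases c) simp_all

lemma euler_prod_nth_0 [simp]: "k > 0 \<Longrightarrow> fps_nth (euler_prod k N) 0 = 1"
  by (induction N) simp_all

lemma tendsto_euler_prod:
  assumes "k > 0"
  shows "euler_prod k \<longlonglongrightarrow> qprod k"
  using has_prod_imp_tendsto'[OF qprod_has_prod[OF assms]] by (simp add: euler_prod_def[abs_def])

lemma tendsto_euler_prod_mult:
  assumes "k > 0" "c > 0"
  shows "(\<lambda>N. euler_prod k (c * N)) \<longlonglongrightarrow> qprod k"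
proof -
  have "strict_mono (\<lambda>N. c * N)" using assms by (simp add: strict_mono_def)
  from LIMSEQ_subseq_LIMSEQ[OF tendsto_euler_prod[OF assms(1)] this] show ?thesis
    by (simp add: o_def)
qed

lemma euler_prod_stable:
  assumes "k > 0" "t \<le> N"
  shows "rcong (fps_X ^ Suc t) (euler_prod k N) (euler_prod k t)"
  using assms(2)
proof (induction N rule: dec_induct)
  case (step N)
  have "Suc t \<le> k * Suc N" using step.hyps assms(1) by (cases k) auto
  then have "fps_X ^ Suc t dvd euler_prod k N * fps_X ^ (k * Suc N)"
    by (intro dvd_mult le_imp_power_dvd)
  moreover have "euler_prod k (Suc N) - euler_prod k N = - (euler_prod k N * fps_X ^ (k * Suc N))"
    by (simp add: algebra_simps)
  ultimately have "rcong (fps_X ^ Suc t) (euler_prod k (Suc N)) (euler_prod k N)"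
    unfolding rcong_def by (metis dvd_minus_iff)
  then show ?case using step.IH by (rule rcong_trans)
qed (rule rcong_refl)

text \<open>By \<open>gauss_binomial_prod\<close>, the Gaussian binomial coefficient is a quotient of products that all
  agree with the infinite product up to the coefficient \<open>t\<close>, one in the numerator and two in the
  denominator. Hence the central coefficients tend to the inverse of the infinite product.\<close>

lemma euler_prod_gauss_binomial:
  assumes "m > 0" "t \<le> k" "k + t \<le> n" "t \<le> N"
  shows "rcong (fps_X ^ Suc t) (euler_prod m N * gauss_binomial (fps_X ^ m) n k) 1"
proof -
  let ?c = "fps_X ^ Suc t :: int fps" and ?G = "gauss_binomial (fps_X ^ m :: int fps) n k"
  have *: "rcong ?c (euler_prod m M) (euler_prod m N)" if "t \<le> M" for M
  proof (rule rcong_trans)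
    show "rcong ?c (euler_prod m M) (euler_prod m t)"
      by (rule euler_prod_stable[OF assms(1) that])
    show "rcong ?c (euler_prod m t) (euler_prod m N)"
      by (rule rcong_sym[OF euler_prod_stable[OF assms(1,4)]])
  qed
  have "rcong ?c (?G * euler_prod m N * euler_prod m N)
      (?G * euler_prod m k * euler_prod m (n - k))"
    using assms by (intro rcong_mult rcong_refl rcong_sym[OF *]) auto
  also have "?G * euler_prod m k * euler_prod m (n - k) = euler_prod m n"
    unfolding euler_prod_def power_mult by (rule gauss_binomial_prod) (use assms in simp)
  also have "rcong ?c (euler_prod m n) (euler_prod m N)"
    using assms by (intro *) simp
  finally have "rcong ?c (?G * euler_prod m N * euler_prod m N) (euler_prod m N)" .
  then have "rcong ?c (euler_prod m N * (euler_prod m N * ?G)) (euler_prod m N * 1)"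
    by (simp add: mult_ac)
  then show ?thesis by (rule rcong_fps_cancel) (use assms in simp)
qed

definition residue_prod :: "nat \<Rightarrow> nat \<Rightarrow> nat \<Rightarrow> int fps" where
  "residue_prod a b N =
    (\<Prod>i<N. 1 - fps_X ^ ((a + b) * i + a)) * (\<Prod>i<N. 1 - fps_X ^ ((a + b) * i + b))"

lemma residue_prod_0 [simp]: "residue_prod a b 0 = 1"
  by (simp add: residue_prod_def)

lemma residue_prod_Suc [simp]: "residue_prod a b (Suc N) =
    residue_prod a b N * ((1 - fps_X ^ ((a + b) * N + a)) * (1 - fps_X ^ ((a + b) * N + b)))"
  by (simp add: residue_prod_def mult_ac)

text \<open>The coefficient \<open>t\<close> is already the final one for \<open>N \<ge> 2 * t\<close>. In the finite identity the
  terms with \<open>t \<le> k \<le> 2 * N - t\<close> have a Gaussian binomial coefficient which the factor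
  \<open>euler_prod (a + b) N\<close> turns into 1 modulo \<open>fps_X ^ Suc t\<close>; in the other terms \<open>k - N\<close>
  exceeds \<open>t\<close> in absolute value, and the exponent then exceeds \<open>t\<close> as well.\<close>

theorem jacobi_triple_product:
  assumes "a > 0" "b > 0"
  shows "(\<lambda>N. euler_prod (a + b) N * residue_prod a b N) \<longlonglongrightarrow> theta a b"
proof (rule tendsto_fpsI)
  fix t
  have "fps_nth (euler_prod (a + b) N * residue_prod a b N) t = fps_nth (theta a b) t"
    if N: "N \<ge> 2 * t" for N
  proof -
    let ?c = "fps_X ^ Suc t :: int fps"
    let ?G = "gauss_binomial (fps_X ^ (a + b) :: int fps) (N + N)"
    let ?W = "\<lambda>k. theta_term a b (int k - int N)"
    have "euler_prod (a + b) N * residue_prod a b N =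
        (\<Sum>k\<le>N + N. euler_prod (a + b) N * ?G k * ?W k)"
      unfolding residue_prod_def finite_jacobi_triple_product[OF assms]
      by (simp add: sum_distrib_left mult.assoc)
    also have "rcong ?c \<dots> (\<Sum>k\<le>N + N. 1 * ?W k)"
    proof (rule rcong_sum)
      fix k assume k: "k \<in> {..N + N}"
      show "rcong ?c (euler_prod (a + b) N * ?G k * ?W k) (1 * ?W k)"
      proof (cases "t \<le> k \<and> k + t \<le> N + N")
        case True
        then show ?thesis
          using assms N by (intro rcong_mult rcong_refl euler_prod_gauss_binomial) auto
      next
        case False
        have "int t < \<bar>int k - int N\<bar>" using False N k by auto
        then have "Suc t \<le> nat (theta_exp a b (int k - int N))"
          using abs_le_theta_exp[OF assms, of "int k - int N"] by linarith
        then have "?c dvd ?W k"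
          unfolding theta_term_def by (intro dvd_mult le_imp_power_dvd)
        then show ?thesis unfolding rcong_def by (intro dvd_diff dvd_mult)
      qed
    qed
    finally have "fps_nth (euler_prod (a + b) N * residue_prod a b N) t =
        fps_nth (\<Sum>k\<le>N + N. ?W k) t"
      by (simp add: rcong_fps_X_power)
    also have "\<dots> = (\<Sum>k\<le>N + N. fps_nth (?W k) t)"
      by (simp add: fps_sum_nth)
    also have "\<dots> = (\<Sum>l\<in>{- int N..int N}. fps_nth (theta_term a b l) t)"
      by (rule sum.reindex_bij_witness[of _ "\<lambda>l. nat (l + int N)" "\<lambda>k. int k - int N"]) auto
    also have "\<dots> = (\<Sum>l | theta_exp a b l = int t. fps_nth (theta_term a b l) t)"
    proof (rule sum.mono_neutral_right)
      show "{l. theta_exp a b l = int t} \<subseteq> {- int N..int N}"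
      proof
        fix l assume "l \<in> {l. theta_exp a b l = int t}"
        then have "\<bar>l\<bar> \<le> int t" using abs_le_theta_exp[OF assms, of l] by simp
        then show "l \<in> {- int N..int N}" using N by auto
      qed
      show "\<forall>l\<in>{- int N..int N} - {l. theta_exp a b l = int t}. fps_nth (theta_term a b l) t = 0"
        using theta_exp_nonneg[OF assms] by (auto simp: theta_term_def)
    qed simp
    also have "\<dots> = fps_nth (theta a b) t"
      by (auto simp: theta_def theta_term_def intro!: sum.cong)
    finally show ?thesis .
  qed
  then show "\<forall>\<^sub>F N in sequentially.
      fps_nth (euler_prod (a + b) N * residue_prod a b N) t = fps_nth (theta a b) t"
    by (rule eventually_sequentiallyI)
qed

section \<open>Three specializations of the triple product\<close>

text \<open>Euler's pentagonal number theorem: the residue classes 0, \<open>k\<close> and \<open>2 * k\<close> modulo \<open>3 * k\<close> make up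
  the multiples of \<open>k\<close>, so the triple product contains exactly the factors of \<open>qprod k\<close>.\<close>

lemma qprod_eq_theta:
  assumes "k > 0"
  shows "qprod k = theta k (2 * k)"
proof -
  have "euler_prod k (3 * N) = euler_prod (k + 2 * k) N * residue_prod k (2 * k) N" for N
  proof (induction N)
    case (Suc N)
    have c: "3 * Suc N = 3 * N + 3" by simp
    have e: "(k + 2 * k) * Suc N = k * (3 * N + 3)" "(k + 2 * k) * N + k = k * (3 * N + 1)"
        "(k + 2 * k) * N + 2 * k = k * (3 * N + 2)"
      by (simp_all add: algebra_simps)
    have "euler_prod k (3 * Suc N) = euler_prod k (3 * N) *
        ((1 - fps_X ^ (k * (3 * N + 1))) * (1 - fps_X ^ (k * (3 * N + 2))) *
         (1 - fps_X ^ (k * (3 * N + 3))))"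
      unfolding c by (simp add: euler_prod_plus mult.assoc)
    then show ?case unfolding euler_prod_Suc residue_prod_Suc e Suc.IH by (simp only: mult_ac)
  qed simp
  moreover have "(\<lambda>N. euler_prod k (3 * N)) \<longlonglongrightarrow> qprod k"
    using assms by (intro tendsto_euler_prod_mult) auto
  moreover have "(\<lambda>N. euler_prod (k + 2 * k) N * residue_prod k (2 * k) N) \<longlonglongrightarrow> theta k (2 * k)"
    using assms by (intro jacobi_triple_product) auto
  ultimately show ?thesis by (simp add: LIMSEQ_unique)
qed

text \<open>Gauss's identity for the triangular numbers: the classes 1 and 3 modulo 4 are the odd numbers, so
  the part of \<open>qprod 1\<close> with exponents in them is \<open>qprod 1\<close> divided by \<open>qprod 2\<close>.\<close>

lemma qprod_mult_theta_1_3: "qprod 1 * qprod 4 = qprod 2 * theta 1 3"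
proof -
  have fin: "euler_prod 1 (4 * N) * euler_prod 4 N =
      euler_prod 2 (2 * N) * (euler_prod 4 N * residue_prod 1 3 N)" for N
  proof (induction N)
    case (Suc N)
    have c: "4 * Suc N = 4 * N + 4"
      by simp_all
    have 1: "euler_prod 1 (4 * Suc N) = euler_prod 1 (4 * N) *
        ((1 - fps_X ^ (4 * N + 1)) * (1 - fps_X ^ (4 * N + 2)) *
         (1 - fps_X ^ (4 * N + 3)) * (1 - fps_X ^ (4 * N + 4)))"
      unfolding c by (simp add: euler_prod_plus mult.assoc)
    have 2: "euler_prod 2 (2 * Suc N) = euler_prod 2 (2 * N) *
        ((1 - fps_X ^ (4 * N + 2)) * (1 - fps_X ^ (4 * N + 4)))"
    proof -
      have "2 * Suc N = Suc (Suc (2 * N))" "2 * Suc (2 * N) = 4 * N + 2"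
        "2 * Suc (Suc (2 * N)) = 4 * N + 4"
        by simp_all
      then show ?thesis by (simp only: euler_prod_Suc mult.assoc)
    qed
    have 3: "residue_prod 1 3 (Suc N) = residue_prod 1 3 N *
        ((1 - fps_X ^ (4 * N + 1)) * (1 - fps_X ^ (4 * N + 3)))"
      by simp
    have 4: "euler_prod 4 (Suc N) = euler_prod 4 N * (1 - fps_X ^ (4 * N + 4))"
      by (simp add: add.commute)
    have "euler_prod 1 (4 * Suc N) * euler_prod 4 (Suc N) =
        (euler_prod 1 (4 * N) * euler_prod 4 N) * ((1 - fps_X ^ (4 * N + 1)) *
        (1 - fps_X ^ (4 * N + 2)) * (1 - fps_X ^ (4 * N + 3)) * (1 - fps_X ^ (4 * N + 4))
        * (1 - fps_X ^ (4 * N + 4)))"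
      unfolding 1 4 by (simp only: mult_ac)
    then show ?case unfolding Suc.IH unfolding 2 3 4 by (simp only: mult_ac)
  qed simp
  have "(\<lambda>N. euler_prod 1 (4 * N) * euler_prod 4 N) \<longlonglongrightarrow> qprod 1 * qprod 4"
    by (intro tendsto_mult_fps tendsto_euler_prod_mult tendsto_euler_prod) auto
  moreover have "(\<lambda>N. euler_prod 2 (2 * N) * (euler_prod 4 N * residue_prod 1 3 N))
      \<longlonglongrightarrow> qprod 2 * theta 1 3"
    using jacobi_triple_product[of 1 3] by (intro tendsto_mult_fps tendsto_euler_prod_mult) auto
  ultimately show ?thesis unfolding fin by (rule LIMSEQ_unique)
qed

text \<open>The classes 1 and 5 modulo 6 consist of the numbers prime to 6, so inclusion and exclusion over the
  divisors 2 and 3 writes the product over them as \<open>qprod 1 * qprod 6\<close> divided by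
  \<open>qprod 2 * qprod 3\<close>. The other \<open>qprod 6\<close> is the factor of the triple product with the exponents
  divisible by 6.\<close>

lemma qprod_mult_theta_1_5: "qprod 1 * qprod 6 * qprod 6 = qprod 2 * qprod 3 * theta 1 5"
proof -
  have fin: "euler_prod 1 (6 * N) * euler_prod 6 N * euler_prod 6 N =
      euler_prod 2 (3 * N) * euler_prod 3 (2 * N) * (euler_prod 6 N * residue_prod 1 5 N)" for N
  proof (induction N)
    case (Suc N)
    have c: "6 * Suc N = 6 * N + 6" "3 * Suc N = 3 * N + 3"
      by simp_all
    have 1: "euler_prod 1 (6 * Suc N) = euler_prod 1 (6 * N) *
        ((1 - fps_X ^ (6 * N + 1)) * (1 - fps_X ^ (6 * N + 2)) *
         (1 - fps_X ^ (6 * N + 3)) * (1 - fps_X ^ (6 * N + 4)) *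
         (1 - fps_X ^ (6 * N + 5)) * (1 - fps_X ^ (6 * N + 6)))"
      unfolding c by (simp add: euler_prod_plus mult.assoc)
    have 2: "euler_prod 2 (3 * Suc N) = euler_prod 2 (3 * N) *
        ((1 - fps_X ^ (6 * N + 2)) * (1 - fps_X ^ (6 * N + 4)) * (1 - fps_X ^ (6 * N + 6)))"
    proof -
      have "3 * Suc N = Suc (Suc (Suc (3 * N)))" "2 * Suc (3 * N) = 6 * N + 2"
        "2 * Suc (Suc (3 * N)) = 6 * N + 4" "2 * Suc (Suc (Suc (3 * N))) = 6 * N + 6"
        by simp_all
      then show ?thesis by (simp only: euler_prod_Suc mult.assoc)
    qed
    have 3: "euler_prod 3 (2 * Suc N) = euler_prod 3 (2 * N) *
        ((1 - fps_X ^ (6 * N + 3)) * (1 - fps_X ^ (6 * N + 6)))"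
    proof -
      have "2 * Suc N = Suc (Suc (2 * N))" "3 * Suc (2 * N) = 6 * N + 3"
        "3 * Suc (Suc (2 * N)) = 6 * N + 6"
        by simp_all
      then show ?thesis by (simp only: euler_prod_Suc mult.assoc)
    qed
    have 4: "residue_prod 1 5 (Suc N) = residue_prod 1 5 N *
        ((1 - fps_X ^ (6 * N + 1)) * (1 - fps_X ^ (6 * N + 5)))"
      by simp
    have 5: "euler_prod 6 (Suc N) = euler_prod 6 N * (1 - fps_X ^ (6 * N + 6))"
      by (simp add: add.commute)
    have "euler_prod 1 (6 * Suc N) * euler_prod 6 (Suc N) * euler_prod 6 (Suc N) =
        (euler_prod 1 (6 * N) * euler_prod 6 N * euler_prod 6 N) * ((1 - fps_X ^ (6 * N + 1)) *
        (1 - fps_X ^ (6 * N + 2)) * (1 - fps_X ^ (6 * N + 3)) * (1 - fps_X ^ (6 * N + 4)) *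
        (1 - fps_X ^ (6 * N + 5)) * (1 - fps_X ^ (6 * N + 6)) *
        (1 - fps_X ^ (6 * N + 6)) * (1 - fps_X ^ (6 * N + 6)))"
      unfolding 1 5 by (simp only: mult_ac)
    then show ?case unfolding Suc.IH unfolding 2 3 4 5 by (simp only: mult_ac)
  qed simp
  have "(\<lambda>N. euler_prod 1 (6 * N) * euler_prod 6 N * euler_prod 6 N) \<longlonglongrightarrow> qprod 1 * qprod 6 * qprod 6"
    by (intro tendsto_mult_fps tendsto_euler_prod_mult tendsto_euler_prod) auto
  moreover have "(\<lambda>N. euler_prod 2 (3 * N) * euler_prod 3 (2 * N) * (euler_prod 6 N * residue_prod 1 5 N))
      \<longlonglongrightarrow> qprod 2 * qprod 3 * theta 1 5"
    using jacobi_triple_product[of 1 5] by (intro tendsto_mult_fps tendsto_euler_prod_mult) auto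
  ultimately show ?thesis unfolding fin by (rule LIMSEQ_unique)
qed

section \<open>Parity of the even-indexed coefficients\<close>

lemma qprod_double:
  assumes "k > 0"
  shows "rcong 2 (qprod (2 * k)) (qprod k ^ 2)"
proof (rule rcong_2_tendsto)
  show "euler_prod (2 * k) \<longlonglongrightarrow> qprod (2 * k)"
    using assms by (intro tendsto_euler_prod) simp
  show "(\<lambda>N. euler_prod k N ^ 2) \<longlonglongrightarrow> qprod k ^ 2"
    unfolding power2_eq_square using assms by (intro tendsto_mult_fps tendsto_euler_prod)
  fix N
  have "rcong 2 (1 - fps_X ^ (2 * k * Suc i) :: int fps) ((1 - fps_X ^ (k * Suc i)) ^ 2)" for i
  proof -
    define x :: "int fps" where "x = fps_X ^ (k * Suc i)"
    have "fps_X ^ (2 * k * Suc i) = x ^ 2"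
      unfolding x_def power_mult[symmetric] by (simp only: mult_ac)
    moreover have "(1 - x ^ 2) - (1 - x) ^ 2 = 2 * (x - x ^ 2)"
      by (simp add: power2_eq_square algebra_simps)
    ultimately show ?thesis unfolding rcong_def x_def[symmetric] by (metis dvd_triv_left)
  qed
  then show "rcong 2 (euler_prod (2 * k) N) (euler_prod k N ^ 2)"
    unfolding euler_prod_def prod_power_distrib by (rule rcong_prod)
qed

definition even_part :: "'a::zero fps \<Rightarrow> 'a fps" where
  "even_part f = Abs_fps (\<lambda>n. fps_nth f (2 * n))"

lemma even_part_nth [simp]: "fps_nth (even_part f) n = fps_nth f (2 * n)"
  by (simp add: even_part_def)

lemma rcong_even_part: "rcong 2 f g \<Longrightarrow> rcong 2 (even_part f) (even_part g)" for f g :: "int fps"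
  by (simp add: rcong_def two_dvd_fps_iff)

lemma fps_compose_X2_nth:
  "fps_nth (f oo fps_X ^ 2) n = (if even n then fps_nth f (n div 2) else 0)"
  for f :: "'a::comm_ring_1 fps"
proof -
  have "fps_nth (f oo fps_X ^ 2) n = (\<Sum>i=0..n. if i = n div 2 \<and> even n then fps_nth f i else 0)"
    unfolding fps_compose_nth by (intro sum.cong refl) (auto simp flip: power_mult)
  also have "\<dots> = (if even n then fps_nth f (n div 2) else 0)"
    by (auto simp: sum.delta)
  finally show ?thesis .
qed

text \<open>A series in $q^2$ multiplies even- and odd-indexed coefficients separately.\<close>

lemma even_part_mult_compose:
  "even_part (f * (g oo fps_X ^ 2)) = even_part f * g" for f g :: "'a::comm_ring_1 fps"
proof (rule fps_ext)
  fix n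
  have "fps_nth (even_part (f * (g oo fps_X ^ 2))) n =
      (\<Sum>i=0..2 * n. fps_nth f i * fps_nth (g oo fps_X ^ 2) (2 * n - i))"
    by (simp add: fps_mult_nth)
  also have "\<dots> = (\<Sum>i\<in>(*) 2 ` {0..n}. fps_nth f i * fps_nth (g oo fps_X ^ 2) (2 * n - i))"
    by (rule sum.mono_neutral_right) (auto simp: fps_compose_X2_nth elim!: evenE)
  also have "\<dots> = (\<Sum>i=0..n. fps_nth f (2 * i) * fps_nth (g oo fps_X ^ 2) (2 * n - 2 * i))"
    by (subst sum.reindex) (auto simp: inj_on_def)
  also have "\<dots> = fps_nth (even_part f * g) n"
    unfolding fps_mult_nth
    by (intro sum.cong refl) (simp add: fps_compose_X2_nth flip: diff_mult_distrib2)
  finally show "fps_nth (even_part (f * (g oo fps_X ^ 2))) n = fps_nth (even_part f * g) n" .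
qed

lemma qprod_2_eq_compose: "qprod 2 = qprod 1 oo fps_X ^ 2"
proof (rule fps_ext)
  fix n
  have "(1 - fps_X ^ (1 * Suc i)) oo fps_X ^ 2 = (1 - fps_X ^ (2 * Suc i) :: int fps)" for i
    unfolding fps_compose_sub_distrib fps_compose_1 mult_1 power_mult
    by (subst fps_X_power_compose) simp_all
  then have "euler_prod 2 N = euler_prod 1 N oo fps_X ^ 2" for N
    unfolding euler_prod_def by (subst fps_compose_prod_distrib) simp_all
  moreover have "\<forall>\<^sub>F N in sequentially. fps_nth (euler_prod 2 N) n = fps_nth (qprod 2) n \<and>
      fps_nth (euler_prod 1 N) (n div 2) = fps_nth (qprod 1) (n div 2)"
    using tendsto_euler_prod[of 1] tendsto_euler_prod[of 2]
    by (auto simp: tendsto_fps_iff eventually_conj_iff)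
  ultimately show "fps_nth (qprod 2) n = fps_nth (qprod 1 oo fps_X ^ 2) n"
    by (auto simp: eventually_sequentially fps_compose_X2_nth)
qed

text \<open>The exponents of \<open>theta 1 5\<close> are $3l^2-2l$ and those of \<open>theta 4 8\<close> are $6k^2-2k$, and
  \<open>l = 2 * k\<close> matches the even ones among the former with the doubles of the latter. The signs differ:
  the even \<open>l\<close> all have sign 1. Hence this is a congruence modulo 2 only.\<close>

lemma even_part_theta_1_5: "rcong 2 (even_part (theta 1 5)) (theta 4 8)"
  unfolding rcong_def two_dvd_fps_iff
proof
  fix t
  have e15: "theta_exp 1 5 l = 3 * (l * l) - 2 * l" for l
    using two_theta_exp[of 1 5 l] by (simp add: algebra_simps)
  have e48: "theta_exp 4 8 k = 6 * (k * k) - 2 * k" for k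
    using two_theta_exp[of 4 8 k] by (simp add: algebra_simps)
  have "(\<Sum>l | theta_exp 1 5 l = int (2 * t). if even l then 1 else - 1 :: int) =
      (\<Sum>k | theta_exp 4 8 k = int t. 1)"
  proof (rule sum.reindex_bij_witness[of _ "\<lambda>k. 2 * k" "\<lambda>l. l div 2"])
    fix l assume "l \<in> {l. theta_exp 1 5 l = int (2 * t)}"
    then have "3 * (l * l) - 2 * l = 2 * int t" unfolding e15[symmetric] by simp
    then have "even (3 * (l * l) - 2 * l)" by simp
    then have "even l" by simp
    then show "2 * (l div 2) = l" "(1::int) = (if even l then 1 else - 1)" by simp_all
    from \<open>even l\<close> obtain k where "l = 2 * k" by (elim evenE)
    with \<open>3 * (l * l) - 2 * l = 2 * int t\<close>
    show "l div 2 \<in> {k. theta_exp 4 8 k = int t}" by (simp add: e48)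
  next
    fix k assume "k \<in> {k. theta_exp 4 8 k = int t}"
    then show "2 * k \<in> {l. theta_exp 1 5 l = int (2 * t)}" unfolding mem_Collect_eq e15 e48 by simp
  qed simp
  then have "fps_nth (even_part (theta 1 5) - theta 4 8) t =
      (\<Sum>k | theta_exp 4 8 k = int t. 1 - (if even k then 1 else - 1))"
    by (simp add: theta_def sum_subtractf)
  also have "even \<dots>" by (intro dvd_sum) simp
  finally show "even (fps_nth (even_part (theta 1 5) - theta 4 8) t)" .
qed

text \<open>The heart of the proof: dissecting \<open>D * f 2 = theta 1 5\<close> (modulo 2) by the parity of the exponents
  identifies the even part of \<open>D\<close> with Gauss's series of the triangular numbers.\<close>

lemma even_part_d: "rcong 2 (even_part (Abs_fps d)) (theta 1 3)"
proof -
  let ?f = "\<lambda>k. qprod k"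
  have f1: "fps_nth (?f k) 0 = 1" if "k > 0" for k using qprod_nth_0[OF that] .
  have f2: "rcong 2 (?f 2) (?f 1 ^ 2)" and f6: "rcong 2 (?f 6) (?f 3 ^ 2)"
    using qprod_double[of 1] qprod_double[of 3] by simp_all
  \<comment> \<open>\<open>f 1 * f 3 ^ 4 = f 1 ^ 2 * f 3 * theta 1 5\<close> modulo 2; then \<open>f 1 * f 3\<close> cancels.\<close>
  have "rcong 2 (?f 1 * ?f 3 ^ 2 * ?f 3 ^ 2) (?f 1 * ?f 6 * ?f 6)"
    by (intro rcong_mult rcong_refl rcong_sym[OF f6])
  also have "?f 1 * ?f 6 * ?f 6 = ?f 2 * ?f 3 * theta 1 5"
    by (rule qprod_mult_theta_1_5)
  also have "rcong 2 (?f 2 * ?f 3 * theta 1 5) (?f 1 ^ 2 * ?f 3 * theta 1 5)"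
    by (intro rcong_mult rcong_refl f2)
  finally have "rcong 2 ((?f 1 * ?f 3) * ?f 3 ^ 3) ((?f 1 * ?f 3) * (?f 1 * theta 1 5))"
    by (simp add: power2_eq_square power3_eq_cube mult_ac)
  then have "rcong 2 (?f 3 ^ 3) (?f 1 * theta 1 5)"
    by (rule rcong_fps_cancel) (simp add: f1)
  then have "rcong 2 (?f 1 * (Abs_fps d * ?f 2)) (?f 1 * theta 1 5)"
    unfolding d_generating_function[symmetric] by (simp add: mult_ac)
  then have "rcong 2 (Abs_fps d * ?f 2) (theta 1 5)"
    by (rule rcong_fps_cancel) (simp add: f1)
  then have "rcong 2 (even_part (Abs_fps d * ?f 2)) (even_part (theta 1 5))"
    by (rule rcong_even_part)
  also have "even_part (Abs_fps d * ?f 2) = even_part (Abs_fps d) * ?f 1"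
    unfolding qprod_2_eq_compose by (rule even_part_mult_compose)
  also note even_part_theta_1_5
  also have "theta 4 8 = ?f 4" using qprod_eq_theta[of 4] by simp
  finally have E: "rcong 2 (?f 1 * even_part (Abs_fps d)) (?f 4)"
    by (simp add: mult.commute)
  \<comment> \<open>Multiplication by \<open>f 1 ^ 2\<close> makes \<open>f 1 * f 4\<close> appear, to which Gauss's identity applies.\<close>
  have "rcong 2 (?f 1 ^ 2 * (?f 1 * even_part (Abs_fps d))) (?f 1 ^ 2 * ?f 4)"
    by (intro rcong_mult rcong_refl E)
  also have "?f 1 ^ 2 * ?f 4 = ?f 1 * (?f 2 * theta 1 3)"
    using qprod_mult_theta_1_3 by (simp add: power2_eq_square mult.assoc)
  also have "rcong 2 (?f 1 * (?f 2 * theta 1 3)) (?f 1 * (?f 1 ^ 2 * theta 1 3))"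
    by (intro rcong_mult rcong_refl f2)
  finally have "rcong 2 (?f 1 ^ 3 * even_part (Abs_fps d)) (?f 1 ^ 3 * theta 1 3)"
    by (simp add: power2_eq_square power3_eq_cube mult_ac)
  then show ?thesis
    by (rule rcong_fps_cancel) (simp add: f1 fps_power_zeroth)
qed

text \<open>The exponent \<open>m\<close> occurs in \<open>theta 1 3\<close> if and only if $m=2l^2-l$ for some \<open>l\<close>, and then
  $8m+1=(4l-1)^2$.\<close>

lemma even_d_double:
  assumes "\<And>y::nat. 8 * m + 1 \<noteq> y ^ 2"
  shows "even (d (2 * m))"
proof -
  have "theta_exp 1 3 l \<noteq> int m" for l
  proof
    assume "theta_exp 1 3 l = int m"
    then have "int m = 2 * (l * l) - l"
      using two_theta_exp[of 1 3 l] by (simp add: algebra_simps)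
    then have "int (8 * m + 1) = (4 * l - 1) ^ 2"
      by (simp add: power2_eq_square algebra_simps)
    also have "\<dots> = int (nat \<bar>4 * l - 1\<bar> ^ 2)" by simp
    finally have "8 * m + 1 = nat \<bar>4 * l - 1\<bar> ^ 2" by (simp only: of_nat_eq_iff)
    with assms show False by blast
  qed
  then have "fps_nth (theta 1 3) m = 0" by (simp add: theta_def)
  with even_part_d show ?thesis
    unfolding rcong_def two_dvd_fps_iff by (metis diff_zero even_part_nth fps_nth_Abs_fps fps_sub_nth)
qed

section \<open>The arithmetic progressions\<close>

lemma odd_multiplicity_not_square:
  fixes p u k y :: nat
  assumes "prime p" "odd k" "\<not> p dvd u"
  shows "u * p ^ k \<noteq> y ^ 2"
proof
  assume eq: "u * p ^ k = y ^ 2"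
  have "u \<noteq> 0" using assms(3) by (metis dvd_0_right)
  have "multiplicity p (u * p ^ k) = k"
    using assms \<open>u \<noteq> 0\<close> prime_gt_0_nat[OF assms(1)]
    by (simp add: prime_elem_multiplicity_mult_distrib not_dvd_imp_multiplicity_0)
  moreover have "y \<noteq> 0" using eq \<open>u \<noteq> 0\<close> prime_gt_0_nat[OF assms(1)] by (intro notI) simp
  then have "multiplicity p (y ^ 2) = 2 * multiplicity p y"
    using assms by (simp add: prime_elem_multiplicity_power_distrib)
  ultimately have "k = 2 * multiplicity p y" using eq by simp
  then show False using assms(2) by simp
qed

theorem theorem5p1:
  fixes n \<alpha> p j :: nat
  assumes "\<alpha> \<ge> 1" and "prime p" and "p \<ge> 3" and "j \<in> {1..p - 1}"
  shows "[d (2 * p ^ (2 * \<alpha>) * n + ((8 * j + p) * p ^ (2 * \<alpha> - 1) - 1) div 4) = 0] (mod 2)"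
proof -
  have "odd p" using assms(2,3) by (simp add: prime_odd_nat)
  then obtain c where c: "p ^ \<alpha> = 2 * c + 1" by (metis even_power oddE)
  \<comment> \<open>\<open>g\<close> is the triangular number with $p^{2\alpha}=8g+1$.\<close>
  obtain g where g: "c * (c + 1) = 2 * g" by (meson evenE even_mult_iff even_plus_one_iff)
  define P where "P = p ^ (2 * \<alpha> - 1)"
  have P: "p * P = p ^ (2 * \<alpha>)"
    unfolding P_def using assms(1) by (cases \<alpha>) simp_all
  also have "\<dots> = 8 * g + 1"
    using g by (simp add: power_mult power2_eq_square c mult.commute[of 2 \<alpha>] algebra_simps)
  finally have pP: "p * P = 8 * g + 1" .
  define m where "m = p * P * n + j * P + g"
  have "(8 * j + p) * P = 8 * (j * P) + (8 * g + 1)"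
    using pP by (simp add: algebra_simps)
  then have "((8 * j + p) * P - 1) div 4 = 2 * (j * P + g)" by simp
  then have index: "2 * p ^ (2 * \<alpha>) * n + ((8 * j + p) * P - 1) div 4 = 2 * m"
    unfolding m_def P[symmetric] by (simp add: algebra_simps)
  have "(8 * p * n + 8 * j + p) * P = 8 * (p * P * n + j * P) + p * P"
    by (simp add: algebra_simps)
  then have "8 * m + 1 = (8 * p * n + 8 * j + p) * P"
    using pP by (simp add: m_def)
  moreover have "\<not> p dvd 8 * p * n + 8 * j + p"
  proof
    assume "p dvd 8 * p * n + 8 * j + p"
    moreover have "8 * p * n + 8 * j + p = p * (8 * n + 1) + 8 * j" by (simp add: algebra_simps)
    ultimately have "p dvd 2 ^ 3 * j" by (simp add: dvd_add_right_iff)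
    then have "p dvd 2 \<or> p dvd j"
      using assms(2) by (metis prime_dvd_mult_iff prime_dvd_power)
    then show False using assms(3,4) by (auto dest!: dvd_imp_le)
  qed
  ultimately have "8 * m + 1 \<noteq> y ^ 2" for y :: nat
    unfolding P_def using assms(1,2) odd_multiplicity_not_square[of p "2 * \<alpha> - 1"] by simp
  then have "even (d (2 * m))" by (rule even_d_double)
  then show ?thesis unfolding cong_0_iff index[unfolded P_def] .
qed

end
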